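(* Let $I\subseteq\mathbb{R}[\mathbf{x}]=\mathbb{R}[x_1,\ldots,x_n]$ be an ideal and let $\mathcal{B}=\{f_0+I,f_1+I,\ldots\}$ be a basis of the vector space $\mathbb{R}[\mathbf{x}]/I$, indexed in order of increasing degree, such that for every $d$, every class $f+I$ of degree $d$ lies in the span of $\mathcal{B}_d$. Then for each positive integer $k$, $$\mathrm{proj}_{\mathbb{R}^{\mathcal{B}_1}}\{\mathbf{y}\in\mathbb{R}^{\mathcal{B}_{2k}} : M_{\mathcal{B}_k}(\mathbf{y})\succeq 0,\ y_0=1\}=\mathbf{f}_1(Q_k(I)),$$ where $y_0$ is the first entry of $\mathbf{y}\in\mathbb{R}^{\mathcal{B}_{2k}}$, $\mathrm{proj}_{\mathbb{R}^{\mathcal{B}_1}}$ is the projection onto the coordinates indexed by $\mathcal{B}_1$, and for $\mathbf{p}\in\mathbb{R}^n$, $\mathbf{f}_1(\mathbf{p}):=(f_i(\mathbf{p}))_{f_i+I\in\mathcal{B}_1}$.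
   Context: The degree of a class is $\deg(f+I):=\min\{\deg g : g-f\in I\}$, and $\mathcal{B}_d:=\{f_l+I\in\mathcal{B} : \deg(f_l+I)\le d\}$. For $g\in\mathbb{R}[\mathbf{x}]$, $\lambda^{(g+I)}=(\lambda^{(g+I)}_l)_l$ denotes the (finitely supported) vector of coordinates of $g+I$ with respect to $\mathcal{B}$. The $k$-th truncated combinatorial moment matrix $M_{\mathcal{B}_k}(\mathbf{y})$ is the symmetric matrix indexed by $\mathcal{B}_k$ whose $(i,j)$ entry is $\sum_l \lambda_l^{(f_if_j+I)}y_l$; under the span assumption on $\mathcal{B}$ it depends only on the entries of $\mathbf{y}$ indexed by $\mathcal{B}_{2k}$. $\succeq 0$ means positive semidefinite. $\mathbb{R}[\mathbf{x}]_k$ is the set of polynomials of degree at most $k$. $\mathcal{M}_k(I):=\{s+I : s=\sum_j h_j^2 \text{ (finite sum)},\ h_j\in\mathbb{R}[\mathbf{x}]_k\}\subseteq\mathbb{R}[\mathbf{x}]/I$; $\mathcal{M}_k(I)^*$ is the set of linear functionals $y$ on $\mathbb{R}[\mathbf{x}]/I$ that are non-negative on $\mathcal{M}_k(I)$; $\mathcal{Y}_1$ is the set of linear functionals $y$ on $\mathbb{R}[\mathbf{x}]/I$ with $y(1+I)=1$; $\pi_I(y)=(y(x_1+I),\ldots,y(x_n+I))\in\mathbb{R}^n$; and $Q_k(I):=\pi_I(\mathcal{M}_k(I)^*\cap\mathcal{Y}_1)$.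
   Formalization: Two conventions are added, without which the claim fails: f_0+I is the class 1+I (so y_0 is the coordinate of 1), and the representatives f_i of the classes in B_1 have degree at most 1. *)

theory Defs
  imports
    "HOL-Analysis.Analysis"
    "HOL-Library.Poly_Mapping"
    "HOL-Library.Set_Algebras"
    "HOL-Library.FuncSet"
begin

section \<open>Real polynomials in finitely many variables\<close>

text \<open>The variables \<open>x\<^sub>1, \<dots>, x\<^sub>n\<close> are indexed by a finite type \<open>'n\<close>; a monomial is its
  exponent vector and a polynomial maps monomials to coefficients.\<close>

type_synonym 'n mpoly = "('n \<Rightarrow>\<^sub>0 nat) \<Rightarrow>\<^sub>0 real"

definition Const :: "real \<Rightarrow> 'n mpoly" where
  "Const c = Poly_Mapping.single 0 c"

definition Var :: "'n \<Rightarrow> 'n mpoly" where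
  "Var i = Poly_Mapping.single (Poly_Mapping.single i 1) 1"

text \<open>The zero polynomial gets degree \<open>0\<close>.\<close>

definition total_degree :: "'n::finite mpoly \<Rightarrow> nat" where
  "total_degree p =
     Max (insert 0 ((\<lambda>m. \<Sum>i\<in>UNIV. Poly_Mapping.lookup m i) ` Poly_Mapping.keys p))"

definition eval_poly :: "'n::finite mpoly \<Rightarrow> real ^ 'n \<Rightarrow> real" where
  "eval_poly p x =
     (\<Sum>m\<in>Poly_Mapping.keys p.
        Poly_Mapping.lookup p m * (\<Prod>i\<in>UNIV. (x $ i) ^ Poly_Mapping.lookup m i))"

section \<open>The quotient by an ideal\<close>

definition is_ideal :: "'n mpoly set \<Rightarrow> bool" where
  "is_ideal I \<longleftrightarrow> module.subspace (*) I"

lemma is_ideal_iff: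
  "is_ideal I \<longleftrightarrow>
     0 \<in> I \<and> (\<forall>p\<in>I. \<forall>q\<in>I. p + q \<in> I) \<and> (\<forall>r. \<forall>p\<in>I. r * p \<in> I)"
proof -
  interpret module "(*) :: 'a mpoly \<Rightarrow> 'a mpoly \<Rightarrow> 'a mpoly"
    by standard (simp_all add: algebra_simps)
  show ?thesis by (auto simp: is_ideal_def subspace_def)
qed

text \<open>The class \<open>g + I\<close> is the coset \<open>g +o I\<close> (a set of polynomials), so its degree is the least
  degree of an element. The vector space operations on classes are
  \<open>(g + I) + (h + I) = (g + h) + I\<close> and \<open>c (g + I) = c g + I\<close>; they are expressed below through
  representatives.\<close>

definition class_degree :: "'n::finite mpoly set \<Rightarrow> nat" where
  "class_degree A = (LEAST d. \<exists>g\<in>A. total_degree g = d)"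

definition lincomb :: "(nat \<Rightarrow> 'n mpoly) \<Rightarrow> (nat \<Rightarrow>\<^sub>0 real) \<Rightarrow> 'n mpoly" where
  "lincomb f c = (\<Sum>l\<in>Poly_Mapping.keys c. Const (Poly_Mapping.lookup c l) * f l)"

definition class_span ::
    "'n mpoly set \<Rightarrow> (nat \<Rightarrow> 'n mpoly) \<Rightarrow> nat set \<Rightarrow> 'n mpoly set set" where
  "class_span I f S = {lincomb f c +o I | c. Poly_Mapping.keys c \<subseteq> S}"

text \<open>The family \<open>(f\<^sub>l + I)\<close>, \<open>l \<in> L\<close>, is linearly independent and spans the quotient. Independence
  also makes the classes pairwise distinct, so subsets of the basis can be handled as sets of
  indices.\<close>

definition is_class_basis ::
    "'n mpoly set \<Rightarrow> nat set \<Rightarrow> (nat \<Rightarrow> 'n mpoly) \<Rightarrow> bool" where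
  "is_class_basis I L f \<longleftrightarrow>
     (\<forall>c. Poly_Mapping.keys c \<subseteq> L \<and> lincomb f c +o I = 0 +o I \<longrightarrow> c = 0) \<and>
     (\<forall>g. g +o I \<in> class_span I f L)"

text \<open>\<open>basis_upto I L f d\<close> is the index set of \<open>\<B>\<^sub>d\<close>.\<close>

definition basis_upto ::
    "'n::finite mpoly set \<Rightarrow> nat set \<Rightarrow> (nat \<Rightarrow> 'n mpoly) \<Rightarrow> nat \<Rightarrow> nat set" where
  "basis_upto I L f d = {l \<in> L. class_degree (f l +o I) \<le> d}"

text \<open>The coordinate vector of a class; it is unique when the family is a basis.\<close>

definition coords ::
    "'n mpoly set \<Rightarrow> nat set \<Rightarrow> (nat \<Rightarrow> 'n mpoly) \<Rightarrow> 'n mpoly set \<Rightarrow> nat \<Rightarrow>\<^sub>0 real" where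
  "coords I L f A = (THE c. Poly_Mapping.keys c \<subseteq> L \<and> A = lincomb f c +o I)"

section \<open>Combinatorial moment matrices\<close>

text \<open>The sum runs over the whole support of the coordinate vector. Vectors \<open>y \<in> \<real>\<^sup>S\<close> are
  extensional functions on \<open>S\<close>. For indices \<open>i, j\<close> of \<open>\<B>\<^sub>k\<close> the span assumption on the basis puts
  the support inside \<open>\<B>\<^bsub>2k\<^esub>\<close>, so for vectors on \<open>\<B>\<^bsub>2k\<^esub>\<close> no value outside the index set
  enters.\<close>

definition moment_entry ::
    "'n mpoly set \<Rightarrow> nat set \<Rightarrow> (nat \<Rightarrow> 'n mpoly) \<Rightarrow> (nat \<Rightarrow> real) \<Rightarrow> nat \<Rightarrow> nat \<Rightarrow> real" where
  "moment_entry I L f y i j =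
     (\<Sum>l\<in>Poly_Mapping.keys (coords I L f ((f i * f j) +o I)).
        Poly_Mapping.lookup (coords I L f ((f i * f j) +o I)) l * y l)"

text \<open>Positive semidefiniteness of a real symmetric matrix indexed by a finite set \<open>S\<close>. It is used
  for the index set of \<open>\<B>\<^sub>k\<close>, which is finite because polynomials of bounded degree form a
  finite-dimensional space.\<close>

definition psd_on :: "nat set \<Rightarrow> (nat \<Rightarrow> nat \<Rightarrow> real) \<Rightarrow> bool" where
  "psd_on S M \<longleftrightarrow>
     (\<forall>i\<in>S. \<forall>j\<in>S. M i j = M j i) \<and>
     (\<forall>v. 0 \<le> (\<Sum>i\<in>S. \<Sum>j\<in>S. v i * M i j * v j))"

section \<open>Sums of squares and the relaxations \<open>Q\<^sub>k(I)\<close>\<close>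

definition sos_cone :: "nat \<Rightarrow> 'n::finite mpoly set \<Rightarrow> 'n mpoly set set" where
  "sos_cone k I =
     {sum_list (map (\<lambda>h. h ^ 2) hs) +o I | hs. \<forall>h\<in>set hs. total_degree h \<le> k}"

text \<open>Linear functionals on the quotient are functions on sets of polynomials of which only the
  values on classes matter.\<close>

definition linear_functionals :: "'n mpoly set \<Rightarrow> ('n mpoly set \<Rightarrow> real) set" where
  "linear_functionals I =
     {y. (\<forall>g h. y ((g + h) +o I) = y (g +o I) + y (h +o I)) \<and>
         (\<forall>c g. y ((Const c * g) +o I) = c * y (g +o I))}"

definition sos_dual :: "nat \<Rightarrow> 'n::finite mpoly set \<Rightarrow> ('n mpoly set \<Rightarrow> real) set" where
  "sos_dual k I = {y \<in> linear_functionals I. \<forall>A\<in>sos_cone k I. 0 \<le> y A}"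

definition normalized_functionals :: "'n mpoly set \<Rightarrow> ('n mpoly set \<Rightarrow> real) set" where
  "normalized_functionals I = {y \<in> linear_functionals I. y (1 +o I) = 1}"

definition pi_map :: "'n::finite mpoly set \<Rightarrow> ('n mpoly set \<Rightarrow> real) \<Rightarrow> real ^ 'n" where
  "pi_map I y = (\<chi> i. y (Var i +o I))"

definition Q_set :: "nat \<Rightarrow> 'n::finite mpoly set \<Rightarrow> (real ^ 'n) set" where
  "Q_set k I = pi_map I ` (sos_dual k I \<inter> normalized_functionals I)"

text \<open>The map \<open>\<^bold>f\<^sub>1\<close> evaluates the chosen representatives, not their classes. It is meaningful
  on the points of \<open>Q\<^sub>k(I)\<close>, which need not be zeros of \<open>I\<close>, only when the representatives of the
  classes in \<open>\<B>\<^sub>1\<close> themselves have degree at most \<open>1\<close>.\<close>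

definition f1_map ::
    "'n::finite mpoly set \<Rightarrow> nat set \<Rightarrow> (nat \<Rightarrow> 'n mpoly) \<Rightarrow> real ^ 'n \<Rightarrow> nat \<Rightarrow> real" where
  "f1_map I L f p = (\<lambda>l\<in>basis_upto I L f 1. eval_poly (f l) p)"

end

theory Submission
  imports Defs
begin

text \<open>A functional on the quotient is determined by its values \<open>y(f\<^sub>l + I)\<close>, and these values may
  be prescribed freely because the classes form a basis. Under this correspondence the quadratic form
  of the truncated moment matrix at \<open>v\<close> is the value of the functional at the class of
  \<open>(\<Sum>\<^sub>i v\<^sub>i f\<^sub>i)\<^sup>2\<close>. By the span assumption, the combinations of the \<open>f\<^sub>i\<close> with \<open>i\<close> in \<open>\<B>\<^sub>k\<close>
  represent exactly the classes of polynomials of degree at most \<open>k\<close>, so positive semidefiniteness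
  says that the functional is non-negative on squares of such polynomials. Finally, a normalized functional
  commutes with affine polynomials, so that \<open>f\<^sub>l(\<pi>\<^sub>I(y)) = y(f\<^sub>l + I)\<close> for \<open>l\<close> in \<open>\<B>\<^sub>1\<close>.\<close>

section \<open>Constants, monomial expansion and total degree\<close>

lemma Const_0 [simp]: "Const 0 = 0"
  by (simp add: Const_def)

lemma Const_1 [simp]: "Const 1 = 1"
  by (simp add: Const_def)

lemma Const_add: "Const (a + b) = Const a + Const b"
  by (simp add: Const_def single_add)

lemma Const_mult: "Const (a * b) = Const a * Const b"
  by (simp add: Const_def mult_single)

lemma keys_Const_mult_subset: "Poly_Mapping.keys (Const a * p) \<subseteq> Poly_Mapping.keys p"
  using keys_mult[of "Const a" p] by (auto simp: Const_def split: if_splits)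

text \<open>Used to determine a linear functional on the quotient from its values at the classes of
  monomials.\<close>

lemma sum_monomials:
  "(\<Sum>m\<in>Poly_Mapping.keys p. Const (Poly_Mapping.lookup p m) * Poly_Mapping.single m 1) = p"
proof (rule poly_mapping_eqI)
  fix m
  have "Poly_Mapping.lookup
      (\<Sum>m\<in>Poly_Mapping.keys p. Const (Poly_Mapping.lookup p m) * Poly_Mapping.single m 1) m
    = (\<Sum>m'\<in>Poly_Mapping.keys p. if m = m' then Poly_Mapping.lookup p m' else 0)"
    by (simp add: lookup_sum Const_def mult_single lookup_single when_def eq_commute)
  also have "\<dots> = Poly_Mapping.lookup p m"
    by (auto simp: sum.delta in_keys_iff)
  finally show "Poly_Mapping.lookup
      (\<Sum>m\<in>Poly_Mapping.keys p. Const (Poly_Mapping.lookup p m) * Poly_Mapping.single m 1) m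
    = Poly_Mapping.lookup p m" .
qed

lemma total_degree_le_iff:
  "total_degree p \<le> d \<longleftrightarrow>
     (\<forall>m\<in>Poly_Mapping.keys p. (\<Sum>i\<in>UNIV. Poly_Mapping.lookup m i) \<le> d)"
  by (simp add: total_degree_def)

lemma total_degree_Const_mult_le:
  "total_degree p \<le> d \<Longrightarrow> total_degree (Const a * p) \<le> d"
  using keys_Const_mult_subset[of a p] by (auto simp: total_degree_le_iff)

lemma total_degree_add_le:
  "total_degree p \<le> d \<Longrightarrow> total_degree q \<le> d \<Longrightarrow> total_degree (p + q) \<le> d"
  using Poly_Mapping.keys_add[of p q] by (auto simp: total_degree_le_iff)

lemma total_degree_sum_le:
  "(\<And>s. s \<in> S \<Longrightarrow> total_degree (g s) \<le> d) \<Longrightarrow> total_degree (sum g S) \<le> d"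
proof (induction S rule: infinite_finite_induct)
  case (insert s S)
  then show ?case by (simp add: total_degree_add_le)
qed (simp_all add: total_degree_le_iff)

lemma total_degree_mult_le:
  assumes "total_degree p \<le> d" "total_degree q \<le> e"
  shows "total_degree (p * q) \<le> d + e"
  unfolding total_degree_le_iff
proof
  fix m assume "m \<in> Poly_Mapping.keys (p * q)"
  then obtain a b where "m = a + b" "a \<in> Poly_Mapping.keys p" "b \<in> Poly_Mapping.keys q"
    using keys_mult[of p q] by blast
  then show "(\<Sum>i\<in>UNIV. Poly_Mapping.lookup m i) \<le> d + e"
    using assms by (auto simp: total_degree_le_iff lookup_add sum.distrib intro: add_mono)
qed

text \<open>Every exponent is bounded by the total degree, so there are finitely many exponent
  functions. This is the source of the finiteness of each truncated basis.\<close>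

lemma finite_monomials:
  "finite {m :: 'n::finite \<Rightarrow>\<^sub>0 nat. (\<Sum>i\<in>UNIV. Poly_Mapping.lookup m i) \<le> d}" (is "finite ?M")
proof (rule finite_imageD)
  have "Poly_Mapping.lookup ` ?M \<subseteq> (UNIV :: 'n set) \<rightarrow>\<^sub>E {..d}"
  proof
    fix u assume "u \<in> Poly_Mapping.lookup ` ?M"
    then have u: "(\<Sum>i\<in>UNIV. u i) \<le> d" by auto
    have "u i \<le> d" for i
      using member_le_sum[of i UNIV u] u by simp
    then show "u \<in> UNIV \<rightarrow>\<^sub>E {..d}" by auto
  qed
  then show "finite (Poly_Mapping.lookup ` ?M)"
    by (rule finite_subset) (simp add: finite_PiE)
  show "inj_on Poly_Mapping.lookup ?M"
    by (simp add: inj_on_def lookup_inject)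
qed

lemma degree_le_1_cases:
  fixes m :: "'n::finite \<Rightarrow>\<^sub>0 nat"
  assumes "(\<Sum>i\<in>UNIV. Poly_Mapping.lookup m i) \<le> 1"
  obtains "m = 0" | i where "m = Poly_Mapping.single i 1"
proof (cases "m = 0")
  case False
  then obtain i where i: "Poly_Mapping.lookup m i \<noteq> 0"
    using poly_mapping_eqI[of m 0] by auto
  \<comment> \<open>With one nonzero exponent and total at most 1, that exponent is 1 and the
    remaining ones sum to 0.\<close>
  have split: "(\<Sum>i\<in>UNIV. Poly_Mapping.lookup m i)
      = Poly_Mapping.lookup m i + (\<Sum>j\<in>UNIV - {i}. Poly_Mapping.lookup m j)"
    by (simp add: sum.remove)
  have one: "Poly_Mapping.lookup m i = 1"
    and rest: "(\<Sum>j\<in>UNIV - {i}. Poly_Mapping.lookup m j) = 0"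
    using i assms unfolding split by linarith+
  have "m = Poly_Mapping.single i 1"
  proof (rule poly_mapping_eqI)
    fix j show "Poly_Mapping.lookup m j = Poly_Mapping.lookup (Poly_Mapping.single i 1) j"
      using one rest by (cases "j = i") (simp_all add: lookup_single when_def)
  qed
  then show thesis by (rule that(2))
qed (rule that(1))

section \<open>Classes modulo an ideal\<close>

lemma class_refl_mem: "is_ideal I \<Longrightarrow> g \<in> g +o I"
  using set_plus_intro2[of 0 I g] by (simp add: is_ideal_iff)

lemma class_eq_iff:
  assumes "is_ideal I"
  shows "g +o I = h +o I \<longleftrightarrow> g - h \<in> I"
proof
  assume "g +o I = h +o I"
  then show "g - h \<in> I"
    using class_refl_mem[OF assms, of g] by (simp add: set_plus_imp_minus)
next
  have add: "p + q \<in> I" if "p \<in> I" "q \<in> I" for p q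
    using assms that by (simp add: is_ideal_iff)
  assume gh: "g - h \<in> I"
  then have "(-1) * (g - h) \<in> I"
    using assms unfolding is_ideal_iff by blast
  then have hg: "h - g \<in> I" by simp
  show "g +o I = h +o I"
  proof (intro equalityI subsetI)
    fix x assume "x \<in> g +o I"
    then have "(x - g) + (g - h) \<in> I"
      using gh by (intro add) (simp_all add: set_plus_imp_minus)
    then show "x \<in> h +o I" by (simp add: set_minus_plus)
  next
    fix x assume "x \<in> h +o I"
    then have "(x - h) + (h - g) \<in> I"
      using hg by (intro add) (simp_all add: set_plus_imp_minus)
    then show "x \<in> g +o I" by (simp add: set_minus_plus)
  qed
qed

lemma class_add_cong:
  assumes "is_ideal I" "g +o I = g' +o I" "h +o I = h' +o I"
  shows "(g + h) +o I = (g' + h') +o I"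
proof -
  have "(g - g') + (h - h') \<in> I"
    using assms unfolding class_eq_iff[OF assms(1)] is_ideal_iff by blast
  also have "(g - g') + (h - h') = g + h - (g' + h')" by simp
  finally show ?thesis by (simp add: class_eq_iff[OF assms(1)])
qed

lemma class_mult_cong:
  assumes "is_ideal I" "g +o I = g' +o I" "h +o I = h' +o I"
  shows "(g * h) +o I = (g' * h') +o I"
proof -
  \<comment> \<open>The mixed product \<open>g' * h\<close> cancels, so the difference of the two
    products is an ideal combination of the two given differences.\<close>
  have "h * (g - g') + g' * (h - h') \<in> I"
    using assms unfolding class_eq_iff[OF assms(1)] is_ideal_iff by blast
  also have "h * (g - g') + g' * (h - h') = g * h - g' * h'"
    by (simp add: right_diff_distrib mult.commute)
  finally show ?thesis by (simp add: class_eq_iff[OF assms(1)])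
qed

lemma class_sum_cong:
  assumes "is_ideal I" "\<And>s. s \<in> S \<Longrightarrow> g s +o I = h s +o I"
  shows "sum g S +o I = sum h S +o I"
  using assms(2)
proof (induction S rule: infinite_finite_induct)
  case (insert s S)
  then have "(g s + sum g S) +o I = (h s + sum h S) +o I"
    by (intro class_add_cong[OF assms(1)]) simp_all
  then show ?case using insert.hyps by simp
qed simp_all

lemma class_degree_le:
  assumes "is_ideal I"
  shows "class_degree (g +o I) \<le> total_degree g"
  unfolding class_degree_def by (rule Least_le) (use class_refl_mem[OF assms] in blast)

text \<open>The minimum defining the degree of a class is attained. This matters because the chosen
  \<open>f l\<close> may have larger degree than its class.\<close>

lemma class_degree_witness:
  assumes "is_ideal I"
  obtains h where "h +o I = g +o I" "total_degree h = class_degree (g +o I)"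
proof -
  have "\<exists>h\<in>g +o I. total_degree h = class_degree (g +o I)"
    unfolding class_degree_def by (rule LeastI_ex) (use class_refl_mem[OF assms] in blast)
  then obtain h where "h \<in> g +o I" "total_degree h = class_degree (g +o I)"
    by blast
  then show thesis
    using that[of h] by (simp add: class_eq_iff[OF assms] set_plus_imp_minus)
qed

section \<open>Linear functionals on the quotient\<close>

lemma
  assumes "y \<in> linear_functionals I"
  shows functional_add: "y ((g + h) +o I) = y (g +o I) + y (h +o I)"
    and functional_Const_mult: "y ((Const c * g) +o I) = c * y (g +o I)"
  using assms by (auto simp: linear_functionals_def)

lemma functional_0: "y \<in> linear_functionals I \<Longrightarrow> y (0 +o I) = 0"
  using functional_Const_mult[of y I 0 0] by simp

lemma functional_sum:
  assumes "y \<in> linear_functionals I"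
  shows "y (sum g S +o I) = (\<Sum>s\<in>S. y (g s +o I))"
  by (induction S rule: infinite_finite_induct)
    (simp_all add: functional_0[OF assms] functional_add[OF assms] del: set_zero_plus)

lemma functional_sum_list:
  assumes "y \<in> linear_functionals I"
  shows "y (sum_list gs +o I) = (\<Sum>g\<leftarrow>gs. y (g +o I))"
  by (induction gs)
    (simp_all add: functional_0[OF assms] functional_add[OF assms] del: set_zero_plus)

lemma functional_lincomb:
  assumes "y \<in> linear_functionals I"
  shows "y (lincomb f c +o I)
    = (\<Sum>l\<in>Poly_Mapping.keys c. Poly_Mapping.lookup c l * y (f l +o I))"
  by (simp add: lincomb_def functional_sum[OF assms] functional_Const_mult[OF assms])

lemma functional_monomials:
  assumes "y \<in> linear_functionals I"
  shows "y (p +o I)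
    = (\<Sum>m\<in>Poly_Mapping.keys p. Poly_Mapping.lookup p m * y (Poly_Mapping.single m 1 +o I))"
  by (subst sum_monomials[of p, symmetric])
    (simp add: functional_sum[OF assms] functional_Const_mult[OF assms])

text \<open>The right-hand side is a quadratic form in \<open>v\<close>, with the shape required by
  \<open>psd_on\<close>; expanding the square and using linearity gives it.\<close>

lemma functional_square:
  assumes "y \<in> linear_functionals I"
  shows "y ((\<Sum>i\<in>S. Const (v i) * f i)\<^sup>2 +o I)
    = (\<Sum>i\<in>S. \<Sum>j\<in>S. v i * y ((f i * f j) +o I) * v j)"
proof -
  have "(\<Sum>i\<in>S. Const (v i) * f i)\<^sup>2 = (\<Sum>i\<in>S. \<Sum>j\<in>S. Const (v i * v j) * (f i * f j))"
    by (simp add: power2_eq_square sum_product Const_mult mult_ac)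
  then show ?thesis
    by (simp add: functional_sum[OF assms] functional_Const_mult[OF assms]) (simp add: mult_ac)
qed

lemma eval_affine_pi_map:
  assumes y: "y \<in> normalized_functionals I" and g: "total_degree g \<le> 1"
  shows "eval_poly g (pi_map I y) = y (g +o I)"
proof -
  have lin: "y \<in> linear_functionals I" and one: "y (1 +o I) = 1"
    using y by (auto simp: normalized_functionals_def)
  have "(\<Prod>i\<in>UNIV. (pi_map I y $ i) ^ Poly_Mapping.lookup m i) = y (Poly_Mapping.single m 1 +o I)"
    if "m \<in> Poly_Mapping.keys g" for m
  proof -
    have "(\<Sum>i\<in>UNIV. Poly_Mapping.lookup m i) \<le> 1"
      using g that by (simp add: total_degree_le_iff)
    then show ?thesis
    proof (cases rule: degree_le_1_cases)
      case 1
      then show ?thesis using one by simp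
    next
      case (2 i)
      have "(\<Prod>j\<in>UNIV. (pi_map I y $ j) ^ Poly_Mapping.lookup m j)
          = (\<Prod>j\<in>UNIV. if j = i then pi_map I y $ i else 1)"
        unfolding 2 by (rule prod.cong) (auto simp: lookup_single when_def)
      then show ?thesis by (simp add: 2 pi_map_def Var_def)
    qed
  qed
  then show ?thesis
    by (simp add: eval_poly_def functional_monomials[OF lin, of g])
qed

section \<open>Coordinates with respect to a basis of the quotient\<close>

text \<open>Supports vary with the coefficient vector; padding with zero terms lets combinations be
  compared over one common index set.\<close>

lemma lincomb_superset:
  assumes "finite S" "Poly_Mapping.keys c \<subseteq> S"
  shows "lincomb f c = (\<Sum>l\<in>S. Const (Poly_Mapping.lookup c l) * f l)"
  unfolding lincomb_def
  by (rule sum.mono_neutral_left) (use assms in \<open>auto simp: in_keys_iff\<close>)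

lemma lincomb_add: "lincomb f (c + d) = lincomb f c + lincomb f d"
proof -
  have "lincomb f e = (\<Sum>l\<in>Poly_Mapping.keys c \<union> Poly_Mapping.keys d.
      Const (Poly_Mapping.lookup e l) * f l)"
    if "e \<in> {c, d, c + d}" for e
    by (rule lincomb_superset) (use that Poly_Mapping.keys_add[of c d] in auto)
  then show ?thesis
    by (simp add: lookup_add Const_add sum.distrib distrib_right)
qed

lemma lookup_map_mult:
  "Poly_Mapping.lookup (Poly_Mapping.map ((*) a) c) l = (a::real) * Poly_Mapping.lookup c l"
  by (simp add: map.rep_eq when_def)

lemma keys_map_mult_subset:
  "Poly_Mapping.keys (Poly_Mapping.map ((*) (a::real)) c) \<subseteq> Poly_Mapping.keys c"
  by (auto simp: in_keys_iff lookup_map_mult)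

lemma lincomb_map_mult: "lincomb f (Poly_Mapping.map ((*) a) c) = Const a * lincomb f c"
  by (subst lincomb_superset[OF finite_keys keys_map_mult_subset])
    (simp add: lincomb_def lookup_map_mult Const_mult sum_distrib_left mult.assoc)

locale class_basis =
  fixes I :: "'n::finite mpoly set" and L :: "nat set" and f :: "nat \<Rightarrow> 'n mpoly"
  assumes ideal: "is_ideal I"
    and basis: "is_class_basis I L f"
begin

abbreviation crd :: "'n mpoly \<Rightarrow> nat \<Rightarrow>\<^sub>0 real" where
  "crd g \<equiv> coords I L f (g +o I)"

lemma lincomb_unique:
  assumes "Poly_Mapping.keys c \<subseteq> L" "Poly_Mapping.keys d \<subseteq> L"
    and "lincomb f c +o I = lincomb f d +o I"
  shows "c = d"
proof -
  \<comment> \<open>The difference of the coefficient vectors represents the zero class, so linear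
    independence forces it to vanish.\<close>
  define e where "e = c + Poly_Mapping.map ((*) (-1)) d"
  have "Const (-1) = - (1 :: 'n mpoly)"
    by (simp add: Const_def single_uminus)
  then have "lincomb f e = lincomb f c - lincomb f d"
    by (simp add: e_def lincomb_add lincomb_map_mult)
  then have "lincomb f e +o I = 0 +o I"
    using assms(3) by (simp add: class_eq_iff[OF ideal] del: set_zero_plus)
  moreover have "Poly_Mapping.keys e \<subseteq> L"
    using assms(1,2) Poly_Mapping.keys_add[of c] keys_map_mult_subset[of "-1" d]
    unfolding e_def by blast
  ultimately have "e = 0"
    using basis unfolding is_class_basis_def by blast
  then have "Poly_Mapping.lookup e l = 0" for l by simp
  then show ?thesis
    by (intro poly_mapping_eqI) (simp add: e_def lookup_add lookup_map_mult)
qed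

lemma crd_eqI:
  assumes "Poly_Mapping.keys c \<subseteq> L" "g +o I = lincomb f c +o I"
  shows "crd g = c"
  unfolding coords_def
  by (rule the_equality) (use assms lincomb_unique in auto)

lemma keys_crd: "Poly_Mapping.keys (crd g) \<subseteq> L"
  and lincomb_crd: "lincomb f (crd g) +o I = g +o I"
proof -
  obtain c where "Poly_Mapping.keys c \<subseteq> L" "g +o I = lincomb f c +o I"
    using basis unfolding is_class_basis_def class_span_def by blast
  then show "Poly_Mapping.keys (crd g) \<subseteq> L" "lincomb f (crd g) +o I = g +o I"
    by (simp_all add: crd_eqI)
qed

lemma crd_add: "crd (g + h) = crd g + crd h"
proof (rule crd_eqI)
  show "Poly_Mapping.keys (crd g + crd h) \<subseteq> L"
    using Poly_Mapping.keys_add[of "crd g" "crd h"] keys_crd[of g] keys_crd[of h] by blast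
  show "(g + h) +o I = lincomb f (crd g + crd h) +o I"
    unfolding lincomb_add by (rule class_add_cong[OF ideal lincomb_crd lincomb_crd, symmetric])
qed

lemma crd_Const_mult: "crd (Const a * g) = Poly_Mapping.map ((*) a) (crd g)"
proof (rule crd_eqI)
  show "Poly_Mapping.keys (Poly_Mapping.map ((*) a) (crd g)) \<subseteq> L"
    by (rule subset_trans[OF keys_map_mult_subset keys_crd])
  show "(Const a * g) +o I = lincomb f (Poly_Mapping.map ((*) a) (crd g)) +o I"
    unfolding lincomb_map_mult
    by (rule class_mult_cong[OF ideal refl lincomb_crd, symmetric])
qed

lemma crd_basis:
  assumes "l \<in> L"
  shows "crd (f l) = Poly_Mapping.single l 1"
  by (rule crd_eqI) (use assms in \<open>simp_all add: lincomb_def\<close>)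

text \<open>The linear functional with prescribed values \<open>Y\<close> on the basis. An entry of
  the moment matrix of \<open>Y\<close> is its value at the class of the product
  \<open>f i * f j\<close>.\<close>

definition coord_functional :: "(nat \<Rightarrow> real) \<Rightarrow> 'n mpoly set \<Rightarrow> real" where
  "coord_functional Y A =
     (\<Sum>l\<in>Poly_Mapping.keys (coords I L f A). Poly_Mapping.lookup (coords I L f A) l * Y l)"

lemma coord_functional_linear: "coord_functional Y \<in> linear_functionals I"
  unfolding linear_functionals_def
proof (intro CollectI conjI allI)
  \<comment> \<open>Cancellation can shrink the support of a sum, so additivity is checked over a
    common finite superset.\<close>
  have superset: "coord_functional Y (g +o I) = (\<Sum>l\<in>S. Poly_Mapping.lookup (crd g) l * Y l)"
    if "finite S" "Poly_Mapping.keys (crd g) \<subseteq> S" for g S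
    unfolding coord_functional_def
    by (rule sum.mono_neutral_left) (use that in \<open>auto simp: in_keys_iff\<close>)
  fix g h a
  define S where "S = Poly_Mapping.keys (crd g) \<union> Poly_Mapping.keys (crd h)"
  have S: "finite S" "Poly_Mapping.keys (crd g) \<subseteq> S" "Poly_Mapping.keys (crd h) \<subseteq> S"
    "Poly_Mapping.keys (crd (g + h)) \<subseteq> S"
    using Poly_Mapping.keys_add[of "crd g" "crd h"] by (auto simp: S_def crd_add)
  show "coord_functional Y ((g + h) +o I)
      = coord_functional Y (g +o I) + coord_functional Y (h +o I)"
    using S by (simp add: superset[of S] crd_add lookup_add distrib_right sum.distrib)
  have "Poly_Mapping.keys (crd (Const a * g)) \<subseteq> Poly_Mapping.keys (crd g)"
    by (simp add: crd_Const_mult keys_map_mult_subset)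
  then show "coord_functional Y ((Const a * g) +o I) = a * coord_functional Y (g +o I)"
    by (simp add: superset[of "Poly_Mapping.keys (crd g)"] crd_Const_mult lookup_map_mult
        sum_distrib_left mult.assoc)
qed

lemma coord_functional_basis: "l \<in> L \<Longrightarrow> coord_functional Y (f l +o I) = Y l"
  by (simp add: coord_functional_def crd_basis)

text \<open>Agreement is required only on the support of the product's coordinates, so a truncated
  vector can be compared with a functional on the whole quotient.\<close>

lemma moment_entry_eq_functional:
  assumes y: "y \<in> linear_functionals I"
    and "\<And>l. l \<in> Poly_Mapping.keys (crd (f i * f j)) \<Longrightarrow> Y l = y (f l +o I)"
  shows "moment_entry I L f Y i j = y ((f i * f j) +o I)"
  by (subst lincomb_crd[symmetric])
    (simp add: moment_entry_def functional_lincomb[OF y] assms(2))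

end

section \<open>The degree filtration and positive semidefinite moment matrices\<close>

locale graded_class_basis = class_basis +
  assumes span: "g +o I \<in> class_span I f (basis_upto I L f (class_degree (g +o I)))"
begin

lemma keys_crd_basis_upto:
  assumes "class_degree (g +o I) \<le> d"
  shows "Poly_Mapping.keys (crd g) \<subseteq> basis_upto I L f d"
proof -
  obtain c where c: "Poly_Mapping.keys c \<subseteq> basis_upto I L f (class_degree (g +o I))"
    "g +o I = lincomb f c +o I"
    using span[of g] unfolding class_span_def by blast
  have "crd g = c"
    by (rule crd_eqI[OF _ c(2)]) (use c(1) in \<open>auto simp: basis_upto_def\<close>)
  then have "Poly_Mapping.keys (crd g) \<subseteq> basis_upto I L f (class_degree (g +o I))"
    using c(1) by simp
  also have "\<dots> \<subseteq> basis_upto I L f d"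
    using assms by (auto simp: basis_upto_def)
  finally show ?thesis .
qed

lemma keys_crd_total_degree:
  "total_degree g \<le> d \<Longrightarrow> Poly_Mapping.keys (crd g) \<subseteq> basis_upto I L f d"
  using class_degree_le[OF ideal, of g] by (intro keys_crd_basis_upto) linarith

lemma basis_upto_representative:
  assumes "l \<in> basis_upto I L f d"
  obtains g where "g +o I = f l +o I" "total_degree g \<le> d"
proof -
  obtain g where "g +o I = f l +o I" "total_degree g = class_degree (f l +o I)"
    by (rule class_degree_witness[OF ideal])
  then show thesis
    using assms that[of g] by (simp add: basis_upto_def)
qed

text \<open>The finitely many monomials of degree at most \<open>d\<close> have coordinates
  supported in a finite set \<open>S\<close>. An index of the truncated basis outside
  \<open>S\<close> would have a coordinate functional killing all these monomials, hence also a
  low-degree representative of its own basis class, where the value must be 1.\<close>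

lemma finite_basis_upto: "finite (basis_upto I L f d)"
proof (rule finite_subset)
  define M where "M = {m :: 'a \<Rightarrow>\<^sub>0 nat. (\<Sum>i\<in>UNIV. Poly_Mapping.lookup m i) \<le> d}"
  define S where "S = (\<Union>m\<in>M. Poly_Mapping.keys (crd (Poly_Mapping.single m 1)))"
  show "finite S"
    unfolding S_def M_def by (intro finite_UN_I finite_monomials finite_keys)
  show "basis_upto I L f d \<subseteq> S"
  proof (rule ccontr)
    assume "\<not> basis_upto I L f d \<subseteq> S"
    then obtain l where l: "l \<in> basis_upto I L f d" "l \<notin> S" by blast
    \<comment> \<open>This functional reads off the coordinate at \<open>l\<close>.\<close>
    define y where "y = coord_functional (\<lambda>l'. if l' = l then 1 else 0)"
    have y: "y \<in> linear_functionals I"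
      by (simp add: y_def coord_functional_linear)
    obtain g where g: "g +o I = f l +o I" "total_degree g \<le> d"
      using l(1) by (rule basis_upto_representative)
    have "y (Poly_Mapping.single m 1 +o I) = 0" if "m \<in> Poly_Mapping.keys g" for m
    proof -
      have "m \<in> M"
        using that g(2) by (simp add: M_def total_degree_le_iff)
      then have "l \<notin> Poly_Mapping.keys (crd (Poly_Mapping.single m 1))"
        using l(2) by (auto simp: S_def)
      then show ?thesis
        unfolding y_def coord_functional_def by (intro sum.neutral) auto
    qed
    then have "y (g +o I) = 0"
      by (simp add: functional_monomials[OF y, of g])
    moreover have "y (f l +o I) = 1"
      using l(1) by (simp add: y_def coord_functional_basis basis_upto_def)
    ultimately show False using g(1) by simp
  qed
qed

text \<open>Serves both inclusions of the theorem. Agreement up to \<open>2 * k\<close> suffices,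
  since products of two representatives of degree at most \<open>k\<close> have coordinates
  supported there.\<close>

lemma psd_on_moment_entry_iff:
  assumes y: "y \<in> linear_functionals I"
    and Y: "\<And>l. l \<in> basis_upto I L f (2 * k) \<Longrightarrow> Y l = y (f l +o I)"
  shows "psd_on (basis_upto I L f k) (moment_entry I L f Y) \<longleftrightarrow> y \<in> sos_dual k I"
proof -
  let ?B = "basis_upto I L f k"
  have entry: "moment_entry I L f Y i j = y ((f i * f j) +o I)" if "i \<in> ?B" "j \<in> ?B" for i j
  proof -
    obtain g h where g: "g +o I = f i +o I" "total_degree g \<le> k"
      and h: "h +o I = f j +o I" "total_degree h \<le> k"
      using \<open>i \<in> ?B\<close> \<open>j \<in> ?B\<close> basis_upto_representative by metis
    have "total_degree (g * h) \<le> 2 * k"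
      using total_degree_mult_le[OF g(2) h(2)] by simp
    then have "Poly_Mapping.keys (crd (f i * f j)) \<subseteq> basis_upto I L f (2 * k)"
      using keys_crd_total_degree class_mult_cong[OF ideal g(1) h(1)] by metis
    then show ?thesis
      using Y by (intro moment_entry_eq_functional[OF y]) auto
  qed
  have form: "(\<Sum>i\<in>?B. \<Sum>j\<in>?B. v i * moment_entry I L f Y i j * v j)
      = y ((\<Sum>i\<in>?B. Const (v i) * f i)\<^sup>2 +o I)" for v
    by (simp add: functional_square[OF y] entry)
  show ?thesis
  proof
    assume psd: "psd_on ?B (moment_entry I L f Y)"
    have square: "0 \<le> y (h\<^sup>2 +o I)" if "total_degree h \<le> k" for h
    proof -
      \<comment> \<open>The test vector for the matrix is the coordinate vector of \<open>h\<close>,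
        supported in \<open>?B\<close> by the degree bound.\<close>
      let ?s = "\<Sum>i\<in>?B. Const (Poly_Mapping.lookup (crd h) i) * f i"
      have "?s = lincomb f (crd h)"
        by (rule lincomb_superset[symmetric, OF finite_basis_upto keys_crd_total_degree[OF that]])
      then have "?s +o I = h +o I" by (simp add: lincomb_crd)
      then have "h\<^sup>2 +o I = ?s\<^sup>2 +o I"
        unfolding power2_eq_square by (intro class_mult_cong[OF ideal]) simp_all
      then show ?thesis
        using psd by (simp add: psd_on_def flip: form)
    qed
    show "y \<in> sos_dual k I"
      unfolding sos_dual_def sos_cone_def
      by (auto simp: y functional_sum_list[OF y] o_def square intro!: sum_list_nonneg)
  next
    assume "y \<in> sos_dual k I"
    then have sos: "0 \<le> y A" if "A \<in> sos_cone k I" for A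
      using that by (simp add: sos_dual_def)
    have "0 \<le> (\<Sum>i\<in>?B. \<Sum>j\<in>?B. v i * moment_entry I L f Y i j * v j)" for v
    proof -
      \<comment> \<open>The cone bounds the degree of the squared polynomials themselves, so each
        \<open>f i\<close> is exchanged for a representative of degree at most \<open>k\<close>; the
        class of the square is unchanged.\<close>
      have "\<forall>i\<in>?B. \<exists>g. g +o I = f i +o I \<and> total_degree g \<le> k"
        by (meson basis_upto_representative)
      then obtain r where r: "\<And>i. i \<in> ?B \<Longrightarrow> r i +o I = f i +o I"
        "\<And>i. i \<in> ?B \<Longrightarrow> total_degree (r i) \<le> k"
        by metis
      let ?h = "\<Sum>i\<in>?B. Const (v i) * r i" and ?s = "\<Sum>i\<in>?B. Const (v i) * f i"
      have "total_degree ?h \<le> k"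
        using r(2) by (intro total_degree_sum_le total_degree_Const_mult_le)
      then have "?h\<^sup>2 +o I \<in> sos_cone k I"
        unfolding sos_cone_def by (intro CollectI exI[of _ "[?h]"]) simp
      moreover have "?h +o I = ?s +o I"
        using r(1) by (intro class_sum_cong class_mult_cong ideal) simp_all
      then have "?h\<^sup>2 +o I = ?s\<^sup>2 +o I"
        unfolding power2_eq_square by (intro class_mult_cong[OF ideal])
      ultimately show ?thesis
        using sos by (simp add: form)
    qed
    \<comment> \<open>Symmetry of the matrix comes from commutativity of the products
      \<open>f i * f j\<close>.\<close>
    then show "psd_on ?B (moment_entry I L f Y)"
      by (auto simp: psd_on_def entry mult.commute)
  qed
qed

end

section \<open>The projected moment vectors and the image of the relaxation\<close>

theorem theorem2p14:
  fixes I :: "'n::finite mpoly set"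
    and L :: "nat set"
    and f :: "nat \<Rightarrow> 'n mpoly"
    and k :: nat
  assumes ideal: "is_ideal I"
    and indices: "L = UNIV \<or> (\<exists>N>0. L = {..<N})"
    and basis: "is_class_basis I L f"
    and increasing: "\<And>i j. i \<in> L \<Longrightarrow> j \<in> L \<Longrightarrow> i \<le> j \<Longrightarrow>
                       class_degree (f i +o I) \<le> class_degree (f j +o I)"
    and span: "\<And>d g. class_degree (g +o I) = d \<Longrightarrow>
                 g +o I \<in> class_span I f (basis_upto I L f d)"
    and first_rep: "f 0 +o I = 1 +o I"
    and linear_reps: "\<And>l. l \<in> basis_upto I L f 1 \<Longrightarrow> total_degree (f l) \<le> 1"
    and k_pos: "k > 0"
  shows "(\<lambda>y. restrict y (basis_upto I L f 1)) `
           {y \<in> basis_upto I L f (2 * k) \<rightarrow>\<^sub>E (UNIV :: real set).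
              psd_on (basis_upto I L f k) (moment_entry I L f y) \<and> y 0 = 1}
         = f1_map I L f ` Q_set k I"
proof -
  interpret graded_class_basis I L f
    by unfold_locales (use ideal basis span in auto)
  let ?B1 = "basis_upto I L f 1" and ?B2k = "basis_upto I L f (2 * k)"
  \<comment> \<open>In the finite case, \<open>N > 0\<close> guarantees the index 0.\<close>
  have "0 \<in> L" using indices by auto
  have "total_degree (1 :: 'n mpoly) = 0"
    by (simp add: total_degree_def)
  then have "class_degree (f 0 +o I) = 0"
    using class_degree_le[OF ideal, of 1] first_rep by simp
  then have zero: "0 \<in> ?B2k"
    using \<open>0 \<in> L\<close> by (simp add: basis_upto_def)
  have sub: "?B1 \<subseteq> ?B2k"
    using k_pos by (auto simp: basis_upto_def)
  have f1: "f1_map I L f (pi_map I y) = (\<lambda>l\<in>?B1. y (f l +o I))"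
    if "y \<in> normalized_functionals I" for y
    unfolding f1_map_def
    by (rule restrict_ext) (rule eval_affine_pi_map[OF that linear_reps])
  show ?thesis
  proof (intro equalityI subsetI)
    fix z
    assume "z \<in> (\<lambda>y. restrict y ?B1) `
      {y \<in> ?B2k \<rightarrow>\<^sub>E UNIV. psd_on (basis_upto I L f k) (moment_entry I L f y) \<and> y 0 = 1}"
    then obtain Y where z: "z = restrict Y ?B1"
      and psd: "psd_on (basis_upto I L f k) (moment_entry I L f Y)" and "Y 0 = 1"
      by blast
    \<comment> \<open>The truncated vector extends to the quotient. At indices of \<open>L\<close>
      beyond \<open>?B2k\<close> the default value of the extensional function \<open>Y\<close> is
      used, which does not affect the matrix.\<close>
    define y where "y = coord_functional Y"
    have lin: "y \<in> linear_functionals I"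
      by (simp add: y_def coord_functional_linear)
    have val: "y (f l +o I) = Y l" if "l \<in> L" for l
      using that by (simp add: y_def coord_functional_basis)
    have "y \<in> sos_dual k I"
      using psd_on_moment_entry_iff[OF lin, of k Y] psd val by (auto simp: basis_upto_def)
    moreover have norm: "y \<in> normalized_functionals I"
      using lin val[OF \<open>0 \<in> L\<close>] \<open>Y 0 = 1\<close> first_rep by (simp add: normalized_functionals_def)
    ultimately have "pi_map I y \<in> Q_set k I"
      by (simp add: Q_set_def)
    moreover have "z = f1_map I L f (pi_map I y)"
      unfolding z f1[OF norm] by (rule restrict_ext) (simp add: val basis_upto_def)
    ultimately show "z \<in> f1_map I L f ` Q_set k I" by blast
  next
    fix z
    assume "z \<in> f1_map I L f ` Q_set k I"
    then obtain y where z: "z = f1_map I L f (pi_map I y)"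
      and y: "y \<in> sos_dual k I" and norm: "y \<in> normalized_functionals I"
      by (auto simp: Q_set_def)
    have lin: "y \<in> linear_functionals I"
      using norm by (simp add: normalized_functionals_def)
    \<comment> \<open>Conversely, the moments of \<open>y\<close> are truncated to
      \<open>?B2k\<close>, making the vector extensional. Since \<open>k > 0\<close>, no entry
      indexed by \<open>?B1\<close> is lost.\<close>
    define Y where "Y = (\<lambda>l\<in>?B2k. y (f l +o I))"
    have "psd_on (basis_upto I L f k) (moment_entry I L f Y)"
      using psd_on_moment_entry_iff[OF lin, of k Y] y by (simp add: Y_def)
    moreover have "Y 0 = 1"
      using zero norm first_rep by (simp add: Y_def normalized_functionals_def)
    moreover have "Y \<in> ?B2k \<rightarrow>\<^sub>E UNIV"
      by (simp add: Y_def)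
    moreover have "z = restrict Y ?B1"
      unfolding z f1[OF norm] by (rule restrict_ext) (use sub in \<open>auto simp: Y_def\<close>)
    ultimately show "z \<in> (\<lambda>y. restrict y ?B1) `
      {y \<in> ?B2k \<rightarrow>\<^sub>E UNIV. psd_on (basis_upto I L f k) (moment_entry I L f y) \<and> y 0 = 1}"
      by blast
  qed
qed

end
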